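(* Let $(P,\wedge)$ be a meet semilattice and $\to$ an extended sectional pseudocomplementation on $P$. Then $\to$ is a normal esp-complementation if and only if the following identities hold for all $x,y,z\in P$: (0) $y\le x\to y$; (1) $x\le (x\to y)\to y$; (2) $x\to z\le (x\wedge y)\to z$. Hence the class of algebras $(P,\wedge,\to)$, where $(P,\wedge)$ is a meet semilattice and $\to$ is a normal esp-complementation on it, is the subvariety determined by the identities (0)--(2) of the variety of all meet semilattices equipped with an extended sectional pseudocomplementation.
   Context: For a poset $P$ and $y\in P$ put $[y)=\{u\in P: y\le u\}$. For $y\le x$, the pseudocomplement $x*y$ of $x$ in $[y)$ is the greatest $u\in[y)$ such that $y$ is the only common lower bound of $u$ and $x$ belonging to $[y)$. $P$ is sectionally pseudocomplemented if $x*y$ exists whenever $y\le x$; then $*$ (a partial operation defined exactly for $y\le x$) is its sectional pseudocomplementation. A total binary operation $\to$ on $P$ is an extended sectional pseudocomplementation (esp-complementation) if, for all $y\le x$, $x\to y$ is the pseudocomplement of $x$ in $[y)$. It is normal if $P$ is sectionally pseudocomplemented and for all $x,y\in P$ the element $x\to y$ is the greatest element of $\{z*y: x\le z,\ y\le z\}$ (which in particular exists). In a meet semilattice, an inequality $a\le b$ is read as the equation $a\wedge b=a$. The class of meet semilattices with an extended sectional pseudocomplementation is the variety determined by the semilattice axioms and the identities $x\wedge(x\to(x\wedge y))=x\wedge y$ and $x\le y\to(x\wedge y)$. *)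

theory Defs
  imports "HOL-Algebra.Lattice"
begin

section \<open>Sectional pseudocomplements in a poset\<close>

definition section_above :: "'a gorder \<Rightarrow> 'a \<Rightarrow> 'a set" where
  "section_above L y = {u \<in> carrier L. y \<sqsubseteq>\<^bsub>L\<^esub> u}"

definition is_section_pc :: "'a gorder \<Rightarrow> 'a \<Rightarrow> 'a \<Rightarrow> 'a \<Rightarrow> bool" where
  "is_section_pc L x y w \<longleftrightarrow>
     greatest L w {u \<in> section_above L y. Lower L {u, x} \<inter> section_above L y = {y}}"

definition sectionally_pseudocomplemented :: "'a gorder \<Rightarrow> bool" where
  "sectionally_pseudocomplemented L \<longleftrightarrow>
     (\<forall>x\<in>carrier L. \<forall>y\<in>carrier L. y \<sqsubseteq>\<^bsub>L\<^esub> x \<longrightarrow> (\<exists>w. is_section_pc L x y w))"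

text \<open>The partial operation $x * y$; it is meaningful only if $y \le x$ and the pseudocomplement
  of $x$ in the section above $y$ exists.\<close>

definition section_pc :: "'a gorder \<Rightarrow> 'a \<Rightarrow> 'a \<Rightarrow> 'a" where
  "section_pc L x y = (THE w. is_section_pc L x y w)"

definition esp_complementation :: "'a gorder \<Rightarrow> ('a \<Rightarrow> 'a \<Rightarrow> 'a) \<Rightarrow> bool" where
  "esp_complementation L i \<longleftrightarrow>
     i \<in> carrier L \<rightarrow> carrier L \<rightarrow> carrier L \<and>
     (\<forall>x\<in>carrier L. \<forall>y\<in>carrier L. y \<sqsubseteq>\<^bsub>L\<^esub> x \<longrightarrow> is_section_pc L x y (i x y))"

definition normal_esp_complementation :: "'a gorder \<Rightarrow> ('a \<Rightarrow> 'a \<Rightarrow> 'a) \<Rightarrow> bool" where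
  "normal_esp_complementation L i \<longleftrightarrow>
     esp_complementation L i \<and>
     sectionally_pseudocomplemented L \<and>
     (\<forall>x\<in>carrier L. \<forall>y\<in>carrier L.
        greatest L (i x y)
          {section_pc L z y | z. z \<in> carrier L \<and> x \<sqsubseteq>\<^bsub>L\<^esub> z \<and> y \<sqsubseteq>\<^bsub>L\<^esub> z})"

section \<open>Algebras of type (2, 2)\<close>

record 'a mi_algebra = "'a partial_object" +
  meet_op :: "'a \<Rightarrow> 'a \<Rightarrow> 'a"
  imp_op :: "'a \<Rightarrow> 'a \<Rightarrow> 'a"

definition mi_algebra :: "'a mi_algebra \<Rightarrow> bool" where
  "mi_algebra A \<longleftrightarrow>
     meet_op A \<in> carrier A \<rightarrow> carrier A \<rightarrow> carrier A \<and>
     imp_op A \<in> carrier A \<rightarrow> carrier A \<rightarrow> carrier A"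

definition meet_semilattice :: "'a mi_algebra \<Rightarrow> bool" where
  "meet_semilattice A \<longleftrightarrow>
     meet_op A \<in> carrier A \<rightarrow> carrier A \<rightarrow> carrier A \<and>
     (\<forall>x\<in>carrier A. \<forall>y\<in>carrier A. \<forall>z\<in>carrier A.
        meet_op A (meet_op A x y) z = meet_op A x (meet_op A y z)) \<and>
     (\<forall>x\<in>carrier A. \<forall>y\<in>carrier A. meet_op A x y = meet_op A y x) \<and>
     (\<forall>x\<in>carrier A. meet_op A x x = x)"

definition meet_order :: "'a mi_algebra \<Rightarrow> 'a gorder" where
  "meet_order A = \<lparr>carrier = carrier A, eq = (=), le = (\<lambda>x y. meet_op A x y = x)\<rparr>"

lemma carrier_meet_order [simp]: "carrier (meet_order A) = carrier A"
  by (simp add: meet_order_def)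

lemma eq_meet_order [simp]: "(.=\<^bsub>meet_order A\<^esub>) = (=)"
  by (simp add: meet_order_def)

lemma le_meet_order: "x \<sqsubseteq>\<^bsub>meet_order A\<^esub> y \<longleftrightarrow> meet_op A x y = x"
  by (simp add: meet_order_def)

text \<open>Under its derived order, a meet semilattice is a lower semilattice in the sense of the
  library, with the given operation as its meet.\<close>

lemma meet_semilattice_lower_semilattice:
  assumes "meet_semilattice A"
  shows "lower_semilattice (meet_order A)"
    and "\<And>x y. x \<in> carrier A \<Longrightarrow> y \<in> carrier A \<Longrightarrow> meet (meet_order A) x y = meet_op A x y"
proof -
  have cl: "meet_op A x y \<in> carrier A" if "x \<in> carrier A" "y \<in> carrier A" for x y
    using assms that by (auto simp: meet_semilattice_def)
  have as: "meet_op A (meet_op A x y) z = meet_op A x (meet_op A y z)"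
    if "x \<in> carrier A" "y \<in> carrier A" "z \<in> carrier A" for x y z
    using assms that by (auto simp: meet_semilattice_def)
  have co: "meet_op A x y = meet_op A y x" if "x \<in> carrier A" "y \<in> carrier A" for x y
    using assms that unfolding meet_semilattice_def by blast
  have idem: "meet_op A x x = x" if "x \<in> carrier A" for x
    using assms that by (auto simp: meet_semilattice_def)
  interpret partial_order "meet_order A"
  proof
    fix x y z
    assume xyz: "x \<in> carrier (meet_order A)" "y \<in> carrier (meet_order A)"
      "z \<in> carrier (meet_order A)"
    assume "x \<sqsubseteq>\<^bsub>meet_order A\<^esub> y" "y \<sqsubseteq>\<^bsub>meet_order A\<^esub> z"
    then show "x \<sqsubseteq>\<^bsub>meet_order A\<^esub> z"
      using as[of x y z] xyz by (simp add: le_meet_order)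
  next
    fix x y
    assume "x \<sqsubseteq>\<^bsub>meet_order A\<^esub> y" "y \<sqsubseteq>\<^bsub>meet_order A\<^esub> x"
      "x \<in> carrier (meet_order A)" "y \<in> carrier (meet_order A)"
    then show "x .=\<^bsub>meet_order A\<^esub> y"
      using co[of x y] by (simp add: le_meet_order)
  qed (auto simp: le_meet_order idem)
  have gr: "greatest (meet_order A) (meet_op A x y) (Lower (meet_order A) {x, y})"
    if xy: "x \<in> carrier A" "y \<in> carrier A" for x y
  proof -
    have "meet_op A (meet_op A x y) x = meet_op A x y"
      using xy as[of x x y] as[of x y x] co[of x y] idem[of x] by metis
    moreover have "meet_op A (meet_op A x y) y = meet_op A x y"
      using xy as[of x y y] idem[of y] by simp
    moreover have "meet_op A z (meet_op A x y) = z"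
      if "z \<in> carrier A" "meet_op A z x = z" "meet_op A z y = z" for z
      using that xy as[of z x y] by simp
    ultimately show ?thesis
      using xy cl[of x y] by (auto simp: greatest_def Lower_def le_meet_order)
  qed
  show ls: "lower_semilattice (meet_order A)"
    by unfold_locales (use gr in auto)
  interpret lower_semilattice "meet_order A" by (rule ls)
  show "meet (meet_order A) x y = meet_op A x y" if "x \<in> carrier A" "y \<in> carrier A" for x y
    unfolding meet_def inf_def
    by (rule some_equality) (use gr[OF that] in \<open>auto intro: greatest_unique\<close>)
qed

definition esp_semilattices :: "'a mi_algebra set" where
  "esp_semilattices =
     {A. meet_semilattice A \<and> esp_complementation (meet_order A) (imp_op A)}"

definition normal_esp_semilattices :: "'a mi_algebra set" where
  "normal_esp_semilattices =
     {A. meet_semilattice A \<and> normal_esp_complementation (meet_order A) (imp_op A)}"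

section \<open>Identities and varieties\<close>

datatype mi_term = Var nat | Meet mi_term mi_term | Imp mi_term mi_term

fun eval_term :: "'a mi_algebra \<Rightarrow> (nat \<Rightarrow> 'a) \<Rightarrow> mi_term \<Rightarrow> 'a" where
  "eval_term A v (Var n) = v n"
| "eval_term A v (Meet s t) = meet_op A (eval_term A v s) (eval_term A v t)"
| "eval_term A v (Imp s t) = imp_op A (eval_term A v s) (eval_term A v t)"

type_synonym identity = "mi_term \<times> mi_term"

definition satisfies :: "'a mi_algebra \<Rightarrow> identity \<Rightarrow> bool" where
  "satisfies A e \<longleftrightarrow>
     (\<forall>v. range v \<subseteq> carrier A \<longrightarrow> eval_term A v (fst e) = eval_term A v (snd e))"

definition variety :: "identity set \<Rightarrow> 'a mi_algebra set" where
  "variety E = {A. mi_algebra A \<and> (\<forall>e\<in>E. satisfies A e)}"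

abbreviation le_identity :: "mi_term \<Rightarrow> mi_term \<Rightarrow> identity" where
  "le_identity s t \<equiv> (Meet s t, s)"

definition semilattice_identities :: "identity set" where
  "semilattice_identities =
    (let x = Var 0; y = Var 1; z = Var 2 in
      {(Meet (Meet x y) z, Meet x (Meet y z)),
       (Meet x y, Meet y x),
       (Meet x x, x)})"

definition esp_identities :: "identity set" where
  "esp_identities =
    (let x = Var 0; y = Var 1 in
      {(Meet x (Imp x (Meet x y)), Meet x y),
       le_identity x (Imp y (Meet x y))})"

definition normality_identities :: "identity set" where
  "normality_identities =
    (let x = Var 0; y = Var 1; z = Var 2 in
      {le_identity y (Imp x y),
       le_identity x (Imp (Imp x y) y),
       le_identity (Imp x z) (Imp (Meet x y) z)})"

end

theory Submission
  imports Defs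
begin

text \<open>In a meet semilattice the pseudocomplement of $x$ in $[y)$ is the greatest $w$ with
  $w \wedge x = y$. For an extended operation satisfying (0)--(2), the element
  $z = (x \to y) \to y$ lies above $x$ and $y$, and $z * y = x \to y$ since both
  $x \to y \le z \to y$ by (1) and $z \to y \le (z \wedge x) \to y$ by (2); so the greatest
  element in the definition of normality is attained at $z$.\<close>

section \<open>Meet semilattices and pseudocomplements in sections\<close>

locale meet_semilattice_algebra =
  fixes A :: "'a mi_algebra" (structure)
  assumes meet_semilattice: "meet_semilattice A"
begin

sublocale lower_semilattice "meet_order A"
  rewrites "carrier (meet_order A) = carrier A"
    and "(.=\<^bsub>meet_order A\<^esub>) = (=)"
  by (simp_all add: meet_semilattice_lower_semilattice(1)[OF meet_semilattice])

abbreviation inf_op (infixl "\<sqinter>" 70) where "x \<sqinter> y \<equiv> meet_op A x y"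
abbreviation imp (infixr "\<leadsto>" 60) where "x \<leadsto> y \<equiv> imp_op A x y"
abbreviation leq (infix "\<preceq>" 50) where "x \<preceq> y \<equiv> x \<sqsubseteq>\<^bsub>meet_order A\<^esub> y"

lemma inf_closed [simp]: "x \<in> carrier A \<Longrightarrow> y \<in> carrier A \<Longrightarrow> x \<sqinter> y \<in> carrier A"
  using meet_semilattice by (auto simp: meet_semilattice_def)

lemma inf_commute: "x \<in> carrier A \<Longrightarrow> y \<in> carrier A \<Longrightarrow> x \<sqinter> y = y \<sqinter> x"
  using meet_semilattice unfolding meet_semilattice_def by blast

lemma inf_lower1: "x \<in> carrier A \<Longrightarrow> y \<in> carrier A \<Longrightarrow> x \<sqinter> y \<preceq> x"
  using meet_left[of x y] meet_semilattice_lower_semilattice(2)[OF meet_semilattice, of x y]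
  by simp

lemma inf_lower2: "x \<in> carrier A \<Longrightarrow> y \<in> carrier A \<Longrightarrow> x \<sqinter> y \<preceq> y"
  using inf_lower1[of y x] by (simp add: inf_commute)

lemma inf_greatest:
  "z \<preceq> x \<Longrightarrow> z \<preceq> y \<Longrightarrow> x \<in> carrier A \<Longrightarrow> y \<in> carrier A \<Longrightarrow> z \<in> carrier A \<Longrightarrow> z \<preceq> x \<sqinter> y"
  using meet_le[of z x y] meet_semilattice_lower_semilattice(2)[OF meet_semilattice, of x y]
  by simp

lemma inf_absorb2: "x \<in> carrier A \<Longrightarrow> y \<in> carrier A \<Longrightarrow> y \<preceq> x \<Longrightarrow> x \<sqinter> y = y"
  by (simp add: inf_commute[of x y] le_meet_order)

text \<open>The common lower bounds of \<open>u\<close> and \<open>x\<close> are the elements below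
  \<open>u \<sqinter> x\<close>. If \<open>u\<close> lies above \<open>y\<close>, then so does
  \<open>u \<sqinter> x\<close>, which is therefore the largest common lower bound in the section;
  it must be \<open>y\<close> if \<open>y\<close> is the only one. Conversely,
  \<open>u \<sqinter> x = y\<close> already forces \<open>y \<preceq> u\<close>, so that membership
  in the section comes with the equation.\<close>

lemma disjoint_in_section_iff:
  assumes "x \<in> carrier A" "y \<in> carrier A" "u \<in> carrier A" "y \<preceq> x"
  shows "u \<in> section_above (meet_order A) y
      \<and> Lower (meet_order A) {u, x} \<inter> section_above (meet_order A) y = {y}
    \<longleftrightarrow> u \<sqinter> x = y"
proof (intro iffI conjI)
  assume a: "u \<in> section_above (meet_order A) y
      \<and> Lower (meet_order A) {u, x} \<inter> section_above (meet_order A) y = {y}"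
  have "y \<preceq> u \<sqinter> x"
    using a assms by (intro inf_greatest) (auto simp: section_above_def)
  then have "u \<sqinter> x \<in> Lower (meet_order A) {u, x} \<inter> section_above (meet_order A) y"
    using assms inf_lower1 inf_lower2 by (auto simp: Lower_def section_above_def)
  then show "u \<sqinter> x = y"
    using a by simp
next
  assume a: "u \<sqinter> x = y"
  then have "y \<preceq> u"
    using assms inf_lower1 by blast
  then show "u \<in> section_above (meet_order A) y"
    using assms by (simp add: section_above_def)
  have "v = y" if "v \<in> carrier A" "v \<preceq> u" "v \<preceq> x" "y \<preceq> v" for v
    using that a assms inf_greatest[of v u x] le_antisym[of v y] by simp
  then show "Lower (meet_order A) {u, x} \<inter> section_above (meet_order A) y = {y}"
    using assms \<open>y \<preceq> u\<close> by (auto simp: Lower_def section_above_def)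
qed

text \<open>Replaces sections and sets of lower bounds by a single equation between meets, so that
  all later arguments about pseudocomplements are computations with \<sqinter>.\<close>

lemma is_section_pc_iff:
  assumes "x \<in> carrier A" "y \<in> carrier A" "y \<preceq> x"
  shows "is_section_pc (meet_order A) x y w \<longleftrightarrow>
    w \<in> carrier A \<and> w \<sqinter> x = y \<and> (\<forall>u\<in>carrier A. u \<sqinter> x = y \<longrightarrow> u \<preceq> w)"
proof -
  have "{u \<in> section_above (meet_order A) y.
      Lower (meet_order A) {u, x} \<inter> section_above (meet_order A) y = {y}}
    = {u \<in> carrier A. u \<sqinter> x = y}"
    using disjoint_in_section_iff[OF assms(1,2) _ assms(3)]
    by (auto simp: section_above_def)
  then show ?thesis
    unfolding is_section_pc_def greatest_def by (auto simp: Upper_def)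
qed

lemma section_pc_eq:
  assumes "is_section_pc (meet_order A) x y w"
  shows "section_pc (meet_order A) x y = w"
  using assms unfolding section_pc_def is_section_pc_def
  by (blast intro: greatest_unique)

text \<open>Since \<open>y \<preceq> x\<close> amounts to \<open>y = x \<sqinter> y\<close>,
  conditions on comparable pairs become equations for arbitrary pairs. The first equation makes the
  value a candidate for the pseudocomplement, the second makes it an upper bound of all
  candidates.\<close>

lemma esp_complementation_iff:
  "esp_complementation (meet_order A) (imp_op A) \<longleftrightarrow>
    imp_op A \<in> carrier A \<rightarrow> carrier A \<rightarrow> carrier A \<and>
    (\<forall>x\<in>carrier A. \<forall>y\<in>carrier A.
      x \<sqinter> (x \<leadsto> x \<sqinter> y) = x \<sqinter> y \<and> x \<preceq> y \<leadsto> x \<sqinter> y)"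
  (is "?L \<longleftrightarrow> ?cl \<and> ?R")
proof (intro iffI conjI ballI)
  assume ?L
  then show ?cl
    by (simp add: esp_complementation_def)
  fix x y assume xy: "x \<in> carrier A" "y \<in> carrier A"
  \<comment> \<open>The element \<open>x \<sqinter> y\<close> lies below both factors, so each
    factor has a pseudocomplement in the section above it. The one of \<open>x\<close> gives the
    first equation; the one of \<open>y\<close> gives the second, because \<open>x\<close> itself is
    a candidate for it.\<close>
  have "is_section_pc (meet_order A) x (x \<sqinter> y) (x \<leadsto> x \<sqinter> y)"
    "is_section_pc (meet_order A) y (x \<sqinter> y) (y \<leadsto> x \<sqinter> y)"
    using \<open>?L\<close> xy inf_lower1[of x y] inf_lower2[of x y] by (simp_all add: esp_complementation_def)
  then show "x \<sqinter> (x \<leadsto> x \<sqinter> y) = x \<sqinter> y" "x \<preceq> y \<leadsto> x \<sqinter> y"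
    using xy inf_lower1[of x y] inf_lower2[of x y] inf_commute[of x "x \<leadsto> x \<sqinter> y"]
    by (simp_all add: is_section_pc_iff)
next
  assume R: "?cl \<and> ?R"
  then have cl: "x \<leadsto> y \<in> carrier A" if "x \<in> carrier A" "y \<in> carrier A" for x y
    using that by auto
  have "is_section_pc (meet_order A) x y (x \<leadsto> y)"
    if xy: "x \<in> carrier A" "y \<in> carrier A" "y \<preceq> x" for x y
  proof -
    have "x \<sqinter> (x \<leadsto> y) = y"
      using R xy inf_absorb2[of x y] by metis
    \<comment> \<open>The second equation at the pair \<open>u\<close>, \<open>x\<close> reads
      \<open>u \<preceq> x \<leadsto> u \<sqinter> x\<close>, and the inner meet is
      \<open>y\<close>.\<close>
    moreover have "u \<preceq> x \<leadsto> y" if "u \<in> carrier A" "u \<sqinter> x = y" for u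
      using R xy that by auto
    ultimately show ?thesis
      using xy cl[of x y] inf_commute[of x "x \<leadsto> y"] by (simp add: is_section_pc_iff)
  qed
  then show ?L
    using R by (simp add: esp_complementation_def)
qed

end

section \<open>Normality of an esp-complementation\<close>

locale esp_semilattice = meet_semilattice_algebra +
  assumes esp: "esp_complementation (meet_order A) (imp_op A)"
begin

lemma imp_closed [simp]: "x \<in> carrier A \<Longrightarrow> y \<in> carrier A \<Longrightarrow> x \<leadsto> y \<in> carrier A"
  using esp by (auto simp: esp_complementation_def)

lemma is_section_pc_imp:
  "x \<in> carrier A \<Longrightarrow> y \<in> carrier A \<Longrightarrow> y \<preceq> x \<Longrightarrow> is_section_pc (meet_order A) x y (x \<leadsto> y)"
  using esp by (auto simp: esp_complementation_def)

lemma
  assumes "x \<in> carrier A" "y \<in> carrier A" "y \<preceq> x"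
  shows inf_imp: "(x \<leadsto> y) \<sqinter> x = y"
    and le_imp: "u \<in> carrier A \<Longrightarrow> u \<sqinter> x = y \<Longrightarrow> u \<preceq> x \<leadsto> y"
  using is_section_pc_imp[OF assms] assms by (simp_all add: is_section_pc_iff)

text \<open>From \<open>y \<sqinter> x = y\<close> it follows that \<open>y\<close> is itself a
  candidate for the pseudocomplement.\<close>

lemma le_imp_self:
  assumes "x \<in> carrier A" "y \<in> carrier A" "y \<preceq> x"
  shows "y \<preceq> x \<leadsto> y"
  using assms by (intro le_imp) (simp_all add: le_meet_order)

text \<open>Greatest elements are unique, so \<open>section_pc\<close> agrees with \<leadsto> on
  every pair \<open>z\<close>, \<open>y\<close> with \<open>y \<preceq> z\<close>; the values of
  \<leadsto> also witness that all sectional pseudocomplements exist.\<close>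

lemma normal_iff_greatest:
  "normal_esp_complementation (meet_order A) (imp_op A) \<longleftrightarrow>
    (\<forall>x\<in>carrier A. \<forall>y\<in>carrier A. greatest (meet_order A) (x \<leadsto> y)
       {z \<leadsto> y | z. z \<in> carrier A \<and> x \<preceq> z \<and> y \<preceq> z})"
proof -
  have "{section_pc (meet_order A) z y | z. z \<in> carrier A \<and> x \<preceq> z \<and> y \<preceq> z} =
      {z \<leadsto> y | z. z \<in> carrier A \<and> x \<preceq> z \<and> y \<preceq> z}" if "y \<in> carrier A" for x y
    using section_pc_eq[OF is_section_pc_imp] that by (intro Collect_cong) metis
  moreover have "sectionally_pseudocomplemented (meet_order A)"
    using is_section_pc_imp by (auto simp: sectionally_pseudocomplemented_def)
  ultimately show ?thesis
    by (simp add: normal_esp_complementation_def esp)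
qed

lemma greatest_section_iff:
  assumes "x \<in> carrier A" "y \<in> carrier A"
  shows "greatest (meet_order A) w {z \<leadsto> y | z. z \<in> carrier A \<and> x \<preceq> z \<and> y \<preceq> z} \<longleftrightarrow>
    (\<exists>z\<in>carrier A. x \<preceq> z \<and> y \<preceq> z \<and> w = z \<leadsto> y) \<and>
    (\<forall>z\<in>carrier A. x \<preceq> z \<longrightarrow> y \<preceq> z \<longrightarrow> z \<leadsto> y \<preceq> w)"
  using assms unfolding greatest_def by (auto simp: Upper_def)

text \<open>Normality yields (0) and (1) because \<open>x \<leadsto> y\<close> equals
  \<open>w \<leadsto> y\<close> for some \<open>w\<close> above both \<open>x\<close> and
  \<open>y\<close>, where \<leadsto> is a true sectional pseudocomplement. It yields (2) because an
  element above \<open>x\<close> is also above \<open>x \<sqinter> y\<close>, so the set of values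
  for \<open>x\<close> is contained in that for \<open>x \<sqinter> y\<close>.\<close>

lemma normal_iff:
  "normal_esp_complementation (meet_order A) (imp_op A) \<longleftrightarrow>
    (\<forall>x\<in>carrier A. \<forall>y\<in>carrier A. \<forall>z\<in>carrier A.
       y \<preceq> x \<leadsto> y \<and> x \<preceq> (x \<leadsto> y) \<leadsto> y \<and> x \<leadsto> z \<preceq> x \<sqinter> y \<leadsto> z)"
  (is "?L \<longleftrightarrow> ?R")
proof
  assume ?L
  then have attained: "\<exists>z\<in>carrier A. x \<preceq> z \<and> y \<preceq> z \<and> x \<leadsto> y = z \<leadsto> y"
    and upper: "z \<in> carrier A \<Longrightarrow> x \<preceq> z \<Longrightarrow> y \<preceq> z \<Longrightarrow> z \<leadsto> y \<preceq> x \<leadsto> y"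
    if "x \<in> carrier A" "y \<in> carrier A" for x y z
    using that by (auto simp: normal_iff_greatest greatest_section_iff)
  show ?R
  proof (intro ballI conjI)
    fix x y z assume xyz: "x \<in> carrier A" "y \<in> carrier A" "z \<in> carrier A"
    obtain w where w: "w \<in> carrier A" "x \<preceq> w" "y \<preceq> w" "x \<leadsto> y = w \<leadsto> y"
      using attained xyz by blast
    show "y \<preceq> x \<leadsto> y"
      using w xyz le_imp_self by simp
    have "w \<sqinter> (w \<leadsto> y) = y"
      using w xyz inf_imp[of w y] inf_commute[of w "w \<leadsto> y"] by simp
    \<comment> \<open>Pseudocomplementation is used a second time, now for
      \<open>w \<leadsto> y\<close>, which lies above \<open>y\<close>: its meet with
      \<open>w\<close> is \<open>y\<close>, so \<open>w\<close> is a candidate.\<close>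
    then have "w \<preceq> (w \<leadsto> y) \<leadsto> y"
      using w xyz le_imp_self by (simp add: le_imp)
    then show "x \<preceq> (x \<leadsto> y) \<leadsto> y"
      using w xyz le_trans[of x w] by simp
    obtain u where u: "u \<in> carrier A" "x \<preceq> u" "z \<preceq> u" "x \<leadsto> z = u \<leadsto> z"
      using attained xyz by blast
    have "x \<sqinter> y \<preceq> u"
      using u xyz inf_lower1 le_trans[of "x \<sqinter> y" x u] by simp
    then show "x \<leadsto> z \<preceq> x \<sqinter> y \<leadsto> z"
      using u xyz upper[of "x \<sqinter> y" z u] by simp
  qed
next
  assume R: ?R
  have "greatest (meet_order A) (x \<leadsto> y) {z \<leadsto> y | z. z \<in> carrier A \<and> x \<preceq> z \<and> y \<preceq> z}"
    if xy: "x \<in> carrier A" "y \<in> carrier A" for x y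
  proof -
    \<comment> \<open>Identity (2) expresses that \<leadsto> is antitone in its first argument,
      since \<open>z \<sqinter> x = x\<close> for \<open>x \<preceq> z\<close>.\<close>
    have upper: "z \<leadsto> y \<preceq> x \<leadsto> y" if "z \<in> carrier A" "x \<preceq> z" for z
      using R xy that inf_absorb2[of z x] by metis
    let ?z = "(x \<leadsto> y) \<leadsto> y"
    \<comment> \<open>The first inequality is (1) at \<open>x\<close>, \<open>y\<close>. The other
      two are (0) and (1) at the pair \<open>x \<leadsto> y\<close>, \<open>y\<close>.\<close>
    have z: "x \<preceq> ?z" "y \<preceq> ?z" "x \<leadsto> y \<preceq> ?z \<leadsto> y"
      using R xy by simp_all
    then have "x \<leadsto> y = ?z \<leadsto> y"
      using xy upper[of ?z] le_antisym[of "x \<leadsto> y" "?z \<leadsto> y"] by simp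
    then show ?thesis
      using xy z upper unfolding greatest_section_iff[OF xy] by (meson imp_closed)
  qed
  then show ?L
    by (simp add: normal_iff_greatest)
qed

end

section \<open>Identities and the varieties they define\<close>

text \<open>Valuations are total on the natural numbers while the identities involve only the
  variables 0, 1 and 2. All remaining variables receive \<open>z\<close>, which keeps the range
  inside the carrier.\<close>

definition assignment :: "'a \<Rightarrow> 'a \<Rightarrow> 'a \<Rightarrow> nat \<Rightarrow> 'a" where
  "assignment x y z n = (if n = 0 then x else if n = 1 then y else z)"

lemma assignment_simps [simp]:
  "assignment x y z 0 = x" "assignment x y z (Suc 0) = y" "assignment x y z 2 = z"
  by (simp_all add: assignment_def)

lemma satisfies_assignment:
  assumes "satisfies A e" "x \<in> carrier A" "y \<in> carrier A" "z \<in> carrier A"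
  shows "eval_term A (assignment x y z) (fst e) = eval_term A (assignment x y z) (snd e)"
proof -
  have "range (assignment x y z) \<subseteq> carrier A"
    using assms by (auto simp: assignment_def)
  then show ?thesis
    using assms(1) by (simp add: satisfies_def)
qed

text \<open>The identities express associativity, commutativity and idempotence; closure of the
  carrier under meet is supplied by \<open>mi_algebra A\<close>.\<close>

lemma satisfies_semilattice_identities:
  assumes "mi_algebra A"
  shows "(\<forall>e\<in>semilattice_identities. satisfies A e) \<longleftrightarrow> meet_semilattice A"
proof
  assume sat: "\<forall>e\<in>semilattice_identities. satisfies A e"
  have "eval_term A (assignment x y z) (fst e) = eval_term A (assignment x y z) (snd e)"
    if "e \<in> semilattice_identities" "x \<in> carrier A" "y \<in> carrier A" "z \<in> carrier A" for e x y z
    using sat that by (blast intro: satisfies_assignment)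
  then show "meet_semilattice A"
    using assms unfolding semilattice_identities_def meet_semilattice_def mi_algebra_def
    by (fastforce simp: Let_def)
next
  assume "meet_semilattice A"
  then show "\<forall>e\<in>semilattice_identities. satisfies A e"
    unfolding semilattice_identities_def meet_semilattice_def satisfies_def Let_def
    by (auto simp: image_subset_iff)
qed

lemma satisfies_esp_identities:
  "(\<forall>e\<in>esp_identities. satisfies A e) \<longleftrightarrow>
    (\<forall>x\<in>carrier A. \<forall>y\<in>carrier A.
       meet_op A x (imp_op A x (meet_op A x y)) = meet_op A x y \<and>
       x \<sqsubseteq>\<^bsub>meet_order A\<^esub> imp_op A y (meet_op A x y))"
proof
  assume sat: "\<forall>e\<in>esp_identities. satisfies A e"
  \<comment> \<open>Only two variables occur, so \<open>y\<close> is repeated as the default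
    value.\<close>
  have "eval_term A (assignment x y y) (fst e) = eval_term A (assignment x y y) (snd e)"
    if "e \<in> esp_identities" "x \<in> carrier A" "y \<in> carrier A" for e x y
    using sat that by (blast intro: satisfies_assignment)
  then show "\<forall>x\<in>carrier A. \<forall>y\<in>carrier A.
       meet_op A x (imp_op A x (meet_op A x y)) = meet_op A x y \<and>
       x \<sqsubseteq>\<^bsub>meet_order A\<^esub> imp_op A y (meet_op A x y)"
    unfolding esp_identities_def by (fastforce simp: Let_def le_meet_order)
qed (auto simp: esp_identities_def satisfies_def Let_def le_meet_order image_subset_iff)

lemma satisfies_normality_identities:
  "(\<forall>e\<in>normality_identities. satisfies A e) \<longleftrightarrow>
    (\<forall>x\<in>carrier A. \<forall>y\<in>carrier A. \<forall>z\<in>carrier A.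
       y \<sqsubseteq>\<^bsub>meet_order A\<^esub> imp_op A x y \<and>
       x \<sqsubseteq>\<^bsub>meet_order A\<^esub> imp_op A (imp_op A x y) y \<and>
       imp_op A x z \<sqsubseteq>\<^bsub>meet_order A\<^esub> imp_op A (meet_op A x y) z)"
  (is "_ \<longleftrightarrow> ?R")
proof
  assume sat: "\<forall>e\<in>normality_identities. satisfies A e"
  have "eval_term A (assignment x y z) (fst e) = eval_term A (assignment x y z) (snd e)"
    if "e \<in> normality_identities" "x \<in> carrier A" "y \<in> carrier A" "z \<in> carrier A" for e x y z
    using sat that by (blast intro: satisfies_assignment)
  then show ?R
    unfolding normality_identities_def by (fastforce simp: Let_def le_meet_order)
qed (auto simp: normality_identities_def satisfies_def Let_def le_meet_order image_subset_iff)

text \<open>The two closure conditions in \<open>mi_algebra\<close> reappear separately: the one for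
  meet inside \<open>meet_semilattice\<close>, the one for the second operation inside
  \<open>esp_complementation\<close>.\<close>

lemma esp_semilattices_eq_variety:
  "(esp_semilattices :: 'a mi_algebra set) = variety (semilattice_identities \<union> esp_identities)"
proof (rule Set.set_eqI)
  fix A :: "'a mi_algebra"
  have "A \<in> variety (semilattice_identities \<union> esp_identities) \<longleftrightarrow>
      mi_algebra A \<and> meet_semilattice A \<and> (\<forall>e\<in>esp_identities. satisfies A e)"
    unfolding variety_def using satisfies_semilattice_identities[of A] by blast
  also have "\<dots> \<longleftrightarrow> meet_semilattice A \<and> esp_complementation (meet_order A) (imp_op A)"
    unfolding satisfies_esp_identities
    using meet_semilattice_algebra.esp_complementation_iff[OF meet_semilattice_algebra.intro, of A]
    by (auto simp: mi_algebra_def meet_semilattice_def)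
  finally show "A \<in> esp_semilattices \<longleftrightarrow>
      A \<in> variety (semilattice_identities \<union> esp_identities)"
    by (simp add: esp_semilattices_def)
qed

lemma normal_esp_complementation_iff:
  assumes "meet_semilattice A" "esp_complementation (meet_order A) (imp_op A)"
  shows "normal_esp_complementation (meet_order A) (imp_op A) \<longleftrightarrow>
    (\<forall>x\<in>carrier A. \<forall>y\<in>carrier A. \<forall>z\<in>carrier A.
       y \<sqsubseteq>\<^bsub>meet_order A\<^esub> imp_op A x y \<and>
       x \<sqsubseteq>\<^bsub>meet_order A\<^esub> imp_op A (imp_op A x y) y \<and>
       imp_op A x z \<sqsubseteq>\<^bsub>meet_order A\<^esub> imp_op A (meet_op A x y) z)"
proof -
  interpret esp_semilattice A
    using assms by unfold_locales
  show ?thesis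
    by (rule normal_iff)
qed

text \<open>A normal operation is an esp-complementation by definition, so the elementwise
  equivalence applies to the members of either side.\<close>

lemma normal_esp_semilattices_eq:
  "(normal_esp_semilattices :: 'a mi_algebra set) =
    {A \<in> esp_semilattices. \<forall>e\<in>normality_identities. satisfies A e}"
proof -
  have "meet_semilattice A \<and> normal_esp_complementation (meet_order A) (imp_op A) \<longleftrightarrow>
      (meet_semilattice A \<and> esp_complementation (meet_order A) (imp_op A)) \<and>
      (\<forall>e\<in>normality_identities. satisfies A e)" for A :: "'a mi_algebra"
    unfolding satisfies_normality_identities
    using normal_esp_complementation_iff[of A]
    by (metis (no_types) normal_esp_complementation_def)
  then show ?thesis
    by (simp add: normal_esp_semilattices_def esp_semilattices_def)
qed

theorem theorem6p13:
  shows "(\<forall>A :: 'a mi_algebra.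
            meet_semilattice A \<longrightarrow> esp_complementation (meet_order A) (imp_op A) \<longrightarrow>
            (normal_esp_complementation (meet_order A) (imp_op A) \<longleftrightarrow>
              (\<forall>x\<in>carrier A. \<forall>y\<in>carrier A. \<forall>z\<in>carrier A.
                 y \<sqsubseteq>\<^bsub>meet_order A\<^esub> imp_op A x y \<and>
                 x \<sqsubseteq>\<^bsub>meet_order A\<^esub> imp_op A (imp_op A x y) y \<and>
                 imp_op A x z \<sqsubseteq>\<^bsub>meet_order A\<^esub> imp_op A (meet_op A x y) z)))
       \<and> (esp_semilattices :: 'a mi_algebra set)
            = variety (semilattice_identities \<union> esp_identities)
       \<and> (normal_esp_semilattices :: 'a mi_algebra set)
            = {A \<in> esp_semilattices. \<forall>e\<in>normality_identities. satisfies A e}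
       \<and> (normal_esp_semilattices :: 'a mi_algebra set)
            = variety (semilattice_identities \<union> esp_identities \<union> normality_identities)"
proof (intro conjI allI impI)
  show "(normal_esp_semilattices :: 'a mi_algebra set)
      = variety (semilattice_identities \<union> esp_identities \<union> normality_identities)"
    \<comment> \<open>The models of a union of sets of identities are the models of one set that
      satisfy the other.\<close>
    unfolding normal_esp_semilattices_eq esp_semilattices_eq_variety by (auto simp: variety_def)
qed (fact normal_esp_complementation_iff esp_semilattices_eq_variety normal_esp_semilattices_eq)+

end
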